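(* (1) There is a graph $X$ and a Markov operator $P$ on it such that $(X,P)$ is transient, uniformly irreducible and has a uniform first moment, but the random walk defined by $(X,P)$ does not converge almost surely to a random end of $X$. (2) Given sequences $p_n\ge 0$ and $\varepsilon_n\ge 0$ ($n\in\mathbb{N}_0$), consider the Markov chain $(\mathbb{Z},P_{p_n,\varepsilon_n})$ defined, for $x\in\mathbb{Z}$ and with $n=|x|$, by $$P(x,y)=\begin{cases}(1-p_n)\frac{1+\varepsilon_n}{2} & \text{for } y=\operatorname{sgn}(x)(|x|+1),\\ (1-p_n)\frac{1-\varepsilon_n}{2} & \text{for } y=\operatorname{sgn}(x)(|x|-1),\\ p_n & \text{for } y=-x,\\ 0 & \text{otherwise.}\end{cases}$$ There is a choice of $p_n\ge 0$ and $\varepsilon_n\ge 0$ such that $(\mathbb{Z},P_{p_n,\varepsilon_n})$ is transient, uniformly irreducible, has uniform first moment and has an infinite expected number of steps where the sign changes. In particular, it verifies the conditions of (1).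
   Context: Here $\operatorname{sgn}(z)=1$ if $z\ge 0$ and $\operatorname{sgn}(z)=-1$ if $z<0$. The sequences are understood to be such that $P$ is a Markov kernel (i.e. $p_n\le 1$, $\varepsilon_n\le 1$). In (2), $\mathbb{Z}$ carries its usual graph structure, with $x$ and $x+1$ neighbours. Graphs are connected and locally finite, $d$ denotes the graph distance, and $p^{(k)}(x,y)$ denotes the $k$-step transition probability of the Markov operator. Transient: for any point, almost every trajectory visits that point only finitely often; equivalently $\sum_{k}p^{(k)}(x,x)<\infty$ for all $x$. Uniformly irreducible: there exist $c>0$ and a finite $K\in\mathbb{N}$ such that for all neighbouring vertices $x$ and $y$ there is $k\le K$ with $p^{(k)}(x,y)\ge c$. Uniform first moment: the step distribution at $x$ is $\sigma_x(n)=\sum_{y:\,d(x,y)=n}p(x,y)$. The step distributions are tight if there is a distribution $\sigma$ on $\mathbb{N}_0$ such that for all $x$ and $n$, $\sigma_x([n,+\infty))\le\sigma([n,+\infty))$. The walk has uniform first moment if the step distributions are tight with some $\sigma$ that has finite first moment, $\sum_n n\sigma(n)<\infty$. Ends: for a finite set $K\subset X$ let $\pi_0(X\setminus K)$ be the set of connected components of the subgraph obtained by deleting the vertices of $K$ and the edges adjacent to them; for $K_1\subseteq K_2$ there is a natural map $\pi_0(X\setminus K_2)\to\pi_0(X\setminus K_1)$ sending a component to the component containing it. The end space is the inverse limit $\varprojlim_K\pi_0(X\setminus K)$ over finite $K\subset X$. A trajectory $(x_n)$ converges to an end $(U_K)_K$ if for every finite $K\subset X$ one has $x_n\in U_K$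 for all sufficiently large $n$. *)

theory Defs
  imports "HOL-Probability.Probability" "Graph_Theory.Graph_Theory"
begin

section \<open>Graphs, distance and ends\<close>

text \<open>Graphs are simple and undirected: every edge is stored as a pair of opposite arcs.
  The vertex set may be infinite. \<open>Digraph_Component.connected\<close> includes that it is nonempty.\<close>

definition loc_finite_graph :: "'a pair_pre_digraph \<Rightarrow> bool" where
  "loc_finite_graph G \<longleftrightarrow>
     pair_bidirected_digraph G \<and> Digraph_Component.connected (with_proj G) \<and>
     (\<forall>x\<in>pverts G. finite {y. (x, y) \<in> parcs G})"

definition gdist :: "'a pair_pre_digraph \<Rightarrow> 'a \<Rightarrow> 'a \<Rightarrow> nat" where
  "gdist G x y = (LEAST n. \<exists>w. pre_digraph.awalk (with_proj G) x w y \<and> length w = n)"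

text \<open>The components of \<open>X \<setminus> K\<close>, as vertex sets. The graph being
  symmetric, its strongly connected components are its connected components.\<close>

definition comps_off :: "'a pair_pre_digraph \<Rightarrow> 'a set \<Rightarrow> 'a set set" where
  "comps_off G K = pre_digraph.sccs_verts (with_proj G \<restriction> (pverts G - K))"

text \<open>The inverse limit of the sets of components over finite \<open>K\<close>. The bonding map sends
  \<open>U K2\<close> to the component of \<open>X \<setminus> K1\<close> containing it, so compatibility is
  the inclusion \<open>U K2 \<subseteq> U K1\<close>.\<close>

definition end_space :: "'a pair_pre_digraph \<Rightarrow> ('a set \<Rightarrow> 'a set) set" where
  "end_space G =
     {U \<in> Pi\<^sub>E {K. finite K \<and> K \<subseteq> pverts G} (comps_off G).
        \<forall>K1 K2. finite K2 \<and> K2 \<subseteq> pverts G \<and> K1 \<subseteq> K2 \<longrightarrow> U K2 \<subseteq> U K1}"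

definition converges_to_end :: "'a pair_pre_digraph \<Rightarrow> (nat \<Rightarrow> 'a) \<Rightarrow> ('a set \<Rightarrow> 'a set) \<Rightarrow> bool" where
  "converges_to_end G \<omega> U \<longleftrightarrow>
     (\<forall>K. finite K \<and> K \<subseteq> pverts G \<longrightarrow> (\<forall>\<^sub>F n in sequentially. \<omega> n \<in> U K))"


section \<open>Markov operators and their trajectories\<close>

definition markov_operator_on :: "'a pair_pre_digraph \<Rightarrow> ('a \<Rightarrow> 'a pmf) \<Rightarrow> bool" where
  "markov_operator_on G P \<longleftrightarrow> (\<forall>x\<in>pverts G. set_pmf (P x) \<subseteq> pverts G)"

primrec kstep :: "('a \<Rightarrow> 'a pmf) \<Rightarrow> nat \<Rightarrow> 'a \<Rightarrow> 'a pmf" where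
  "kstep P 0 x = return_pmf x"
| "kstep P (Suc k) x = bind_pmf (P x) (kstep P k)"

text \<open>The law of coordinate \<open>n\<close> of the trajectory started at \<open>x\<close>, given the coordinates below \<open>n\<close>.\<close>

definition next_law :: "('a \<Rightarrow> 'a pmf) \<Rightarrow> 'a \<Rightarrow> nat \<Rightarrow> (nat \<Rightarrow> 'a) \<Rightarrow> 'a measure" where
  "next_law P x n \<omega> = measure_pmf (case n of 0 \<Rightarrow> return_pmf x | Suc m \<Rightarrow> P (\<omega> m))"

lemma Ionescu_Tulcea_next_law: "Ionescu_Tulcea (next_law P x) (\<lambda>_. count_space UNIV)"
proof (rule Ionescu_Tulcea.intro)
  fix n :: nat
  show "next_law P x n \<in> measurable (PiM {0..<n} (\<lambda>_. count_space UNIV)) (subprob_algebra (count_space UNIV))"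
  proof (cases n)
    case 0
    then show ?thesis
      by (auto simp: next_law_def[abs_def] space_subprob_algebra
               intro!: measurable_const prob_space_imp_subprob_space prob_space_measure_pmf)
  next
    case (Suc m)
    have "(\<lambda>\<omega>. \<omega> m) \<in> measurable (PiM {0..<n} (\<lambda>_. count_space UNIV)) (count_space UNIV)"
      by (rule measurable_component_singleton) (simp add: Suc)
    moreover have "(\<lambda>y. measure_pmf (P y)) \<in> measurable (count_space UNIV) (subprob_algebra (count_space UNIV))"
      by (auto simp: space_subprob_algebra intro!: prob_space_imp_subprob_space prob_space_measure_pmf)
    ultimately show ?thesis
      by (simp add: Suc next_law_def[abs_def])
  qed
next
  show "prob_space (next_law P x n \<omega>)" for n \<omega>
    unfolding next_law_def by (rule prob_space_measure_pmf)
qed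

text \<open>The law of the trajectory \<open>(x\<^sub>0, x\<^sub>1, \<dots>)\<close> with \<open>x\<^sub>0 = x\<close>, a probability measure on \<open>nat \<Rightarrow> 'a\<close>
  with the product sigma-algebra.\<close>

definition path_measure :: "('a \<Rightarrow> 'a pmf) \<Rightarrow> 'a \<Rightarrow> (nat \<Rightarrow> 'a) measure" where
  "path_measure P x =
     projective_family.lim UNIV
       (Ionescu_Tulcea.CI (next_law P x) (\<lambda>_. count_space UNIV)) (\<lambda>_. count_space UNIV)"

definition transient_walk :: "'a pair_pre_digraph \<Rightarrow> ('a \<Rightarrow> 'a pmf) \<Rightarrow> bool" where
  "transient_walk G P \<longleftrightarrow>
     (\<forall>x\<in>pverts G. \<forall>y\<in>pverts G. AE \<omega> in path_measure P x. finite {n. \<omega> n = y})"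

definition uniformly_irreducible :: "'a pair_pre_digraph \<Rightarrow> ('a \<Rightarrow> 'a pmf) \<Rightarrow> bool" where
  "uniformly_irreducible G P \<longleftrightarrow>
     (\<exists>c>0. \<exists>K. \<forall>(x, y)\<in>parcs G. \<exists>k\<le>K. pmf (kstep P k x) y \<ge> c)"

definition step_distribution :: "'a pair_pre_digraph \<Rightarrow> ('a \<Rightarrow> 'a pmf) \<Rightarrow> 'a \<Rightarrow> nat pmf" where
  "step_distribution G P x = map_pmf (gdist G x) (P x)"

definition steps_tight_with :: "'a pair_pre_digraph \<Rightarrow> ('a \<Rightarrow> 'a pmf) \<Rightarrow> nat pmf \<Rightarrow> bool" where
  "steps_tight_with G P \<sigma> \<longleftrightarrow>
     (\<forall>x\<in>pverts G. \<forall>n. measure_pmf.prob (step_distribution G P x) {n..} \<le> measure_pmf.prob \<sigma> {n..})"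

definition uniform_first_moment :: "'a pair_pre_digraph \<Rightarrow> ('a \<Rightarrow> 'a pmf) \<Rightarrow> bool" where
  "uniform_first_moment G P \<longleftrightarrow>
     (\<exists>\<sigma>. steps_tight_with G P \<sigma> \<and> summable (\<lambda>n. real n * pmf \<sigma> n))"

definition converges_as_to_end :: "'a pair_pre_digraph \<Rightarrow> ('a \<Rightarrow> 'a pmf) \<Rightarrow> bool" where
  "converges_as_to_end G P \<longleftrightarrow>
     (\<forall>x\<in>pverts G. AE \<omega> in path_measure P x. \<exists>U\<in>end_space G. converges_to_end G \<omega> U)"


section \<open>The sign-flipping chain on the integers\<close>

definition int_line :: "int pair_pre_digraph" where
  "int_line = \<lparr> pverts = UNIV, parcs = {(x, y). \<bar>x - y\<bar> = 1} \<rparr>"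

text \<open>Unlike the library's \<open>sgn\<close>, this is \<open>1\<close> at \<open>0\<close>.\<close>

definition sgn1 :: "int \<Rightarrow> int" where
  "sgn1 z = (if z \<ge> 0 then 1 else -1)"

definition flip_prob :: "(nat \<Rightarrow> real) \<Rightarrow> (nat \<Rightarrow> real) \<Rightarrow> int \<Rightarrow> int \<Rightarrow> real" where
  "flip_prob p \<epsilon> x y =
     (let n = nat \<bar>x\<bar> in
      if y = sgn1 x * (\<bar>x\<bar> + 1) then (1 - p n) * ((1 + \<epsilon> n) / 2)
      else if y = sgn1 x * (\<bar>x\<bar> - 1) then (1 - p n) * ((1 - \<epsilon> n) / 2)
      else if y = - x then p n
      else 0)"

definition flip_params :: "(nat \<Rightarrow> real) \<Rightarrow> (nat \<Rightarrow> real) \<Rightarrow> bool" where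
  "flip_params p \<epsilon> \<longleftrightarrow> (\<forall>n. 0 \<le> p n \<and> p n \<le> 1 \<and> 0 \<le> \<epsilon> n \<and> \<epsilon> n \<le> 1)"

definition flip_chain :: "(nat \<Rightarrow> real) \<Rightarrow> (nat \<Rightarrow> real) \<Rightarrow> int \<Rightarrow> int pmf" where
  "flip_chain p \<epsilon> x = embed_pmf (flip_prob p \<epsilon> x)"

lemma pmf_flip_chain:
  assumes "flip_params p \<epsilon>"
  shows "pmf (flip_chain p \<epsilon> x) y = flip_prob p \<epsilon> x y"
proof -
  let ?a = "sgn1 x * (\<bar>x\<bar> + 1)" and ?b = "sgn1 x * (\<bar>x\<bar> - 1)"
  have distinct: "?a \<noteq> ?b" "?a \<noteq> - x" "?b \<noteq> - x"
    unfolding sgn1_def by presburger+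
  have nonneg: "0 \<le> flip_prob p \<epsilon> x z" for z
    using assms by (auto simp: flip_params_def flip_prob_def Let_def)
  have supp: "flip_prob p \<epsilon> x z = 0" if "z \<notin> {?a, ?b, - x}" for z
    using that by (auto simp: flip_prob_def Let_def)
  have "(\<integral>\<^sup>+z. ennreal (flip_prob p \<epsilon> x z) \<partial>count_space UNIV) =
        (\<integral>\<^sup>+z. ennreal (flip_prob p \<epsilon> x z) \<partial>count_space {?a, ?b, - x})"
    by (rule nn_integral_count_space_eq) (use supp in auto)
  also have "\<dots> = (\<Sum>z\<in>{?a, ?b, - x}. ennreal (flip_prob p \<epsilon> x z))"
    by (rule nn_integral_count_space_finite) simp
  also have "\<dots> = ennreal (\<Sum>z\<in>{?a, ?b, - x}. flip_prob p \<epsilon> x z)"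
    by (rule sum_ennreal) (rule nonneg)
  also have "(\<Sum>z\<in>{?a, ?b, - x}. flip_prob p \<epsilon> x z) =
      flip_prob p \<epsilon> x ?a + (flip_prob p \<epsilon> x ?b + flip_prob p \<epsilon> x (- x))"
    using distinct by simp
  also have "\<dots> = 1"
    using distinct by (simp add: flip_prob_def Let_def field_simps)
  finally show ?thesis
    unfolding flip_chain_def by (intro pmf_embed_pmf nonneg) simp
qed

definition expected_sign_changes :: "(int \<Rightarrow> int pmf) \<Rightarrow> int \<Rightarrow> ennreal" where
  "expected_sign_changes P x =
     (\<integral>\<^sup>+\<omega>. (\<Sum>k. of_bool (sgn1 (\<omega> (Suc k)) \<noteq> sgn1 (\<omega> k))) \<partial>path_measure P x)"

end

theory Submission
  imports Defs
begin

text \<open>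
  The example is the chain of the second claim with \<open>\<epsilon>\<^sub>n = 1 / (n + 1)\<close> and
  \<open>p\<^sub>n = n / (n + 1)\<^sup>3\<close>. Apart from reflections, its absolute value is the discrete
  three-dimensional Bessel process, which escapes to infinity so slowly that it spends time of
  order \<open>n\<close> at distance \<open>n\<close> from the origin. Reflections \<open>x \<mapsto> -x\<close> do not affect the absolute
  value. They occur at distance \<open>n\<close> at a rate of order \<open>1 / n\<^sup>2\<close>: rarely enough for a uniform
  first moment, since jumps of length \<open>2 n\<close> then have summable tails, but often enough to occur
  infinitely often, since the sum of \<open>n * p\<^sub>n\<close> diverges.

  Transience follows from the potential \<open>1 / (\<bar>x\<bar> + 2)\<close>, which is strictly superharmonic everywhere
  (\<open>AE_finite_visits_if_superharmonic\<close>, \<open>radial_potential_drop\<close>).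

  For the sign changes a statement stronger than infinite expectation is proved: almost surely there are
  infinitely many of them. By the Markov property it is enough that the probability \<open>u x\<close> of
  never changing sign from \<open>x\<close> is zero (\<open>AE_infinitely_often_not_if_restricted_vanishes\<close>). Apart from
  reflections the absolute value is a Doob transform of simple random walk, so on a half-line \<open>w n = (n + 1) u n\<close> satisfies the discrete Schroedinger
  equation \<open>w (n + 1) - 2 w n + w (n - 1) = q n * w n\<close> with zero boundary value and \<open>q n \<ge> 2 p\<^sub>n\<close>, and
  \<open>w n \<le> n + 1\<close>. Divergence of the sum of \<open>n * q n\<close> forces \<open>w = 0\<close> (\<open>convex_sequence_forced_zero\<close>).

  A trajectory that converges to an end of the line stays on one side of the origin from some time on
  (\<open>not_converges_to_end_if_sign_alternates\<close>), so almost no trajectory converges.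
\<close>

section \<open>The law of the trajectory\<close>

lemma sets_path_measure [measurable_cong]:
  "sets (path_measure P x) = sets (PiM UNIV (\<lambda>_. count_space UNIV))"
proof -
  interpret Ionescu_Tulcea "next_law P x" "\<lambda>_. count_space UNIV"
    by (rule Ionescu_Tulcea_next_law)
  show ?thesis
    unfolding path_measure_def by (rule PF.sets_lim)
qed

lemma space_path_measure [simp]: "space (path_measure P x) = UNIV"
  using sets_eq_imp_space_eq[OF sets_path_measure, of P x] by (simp add: space_PiM PiE_UNIV_domain)

lemma prob_space_path_measure: "prob_space (path_measure P x)"
proof -
  interpret Ionescu_Tulcea "next_law P x" "\<lambda>_. count_space UNIV"
    by (rule Ionescu_Tulcea_next_law)
  interpret F: prob_space "distr (path_measure P x) (PiM {} (\<lambda>_. count_space UNIV)) (\<lambda>\<omega>. restrict \<omega> {})"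
    unfolding path_measure_def by (subst distr_lim) (auto intro: PF.prob_space_P)
  show ?thesis
    by (rule prob_space_distrD[OF _ F.prob_space_axioms]) measurable
qed

text \<open>The law of the trajectory is a projective limit; this identifies its finite-dimensional
  marginals with the iterated kernels of the Ionescu-Tulcea construction.\<close>
lemma distr_path_measure_initial:
  "distr (path_measure P x) (PiM {0..<n} (\<lambda>_. count_space UNIV)) (\<lambda>\<omega>. restrict \<omega> {0..<n}) =
    Ionescu_Tulcea.C (next_law P x) (\<lambda>_. count_space UNIV) 0 n (\<lambda>_. undefined)"
proof -
  interpret Ionescu_Tulcea "next_law P x" "\<lambda>_. count_space UNIV"
    by (rule Ionescu_Tulcea_next_law)
  have undef: "(\<lambda>_. undefined) \<in> space (PiM {0..<0} (\<lambda>_. count_space UNIV))"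
    by (auto simp: space_PiM PiE_def extensional_def)
  have "distr (path_measure P x) (PiM {0..<n} (\<lambda>_. count_space UNIV)) (\<lambda>\<omega>. restrict \<omega> {0..<n}) = CI {0..<n}"
    unfolding path_measure_def by (rule distr_lim) simp
  also have "\<dots> = C 0 n (\<lambda>_. undefined)"
  proof (rule measure_eqI)
    show "sets (CI {0..<n}) = sets (C 0 n (\<lambda>_. undefined))"
      using sets_C[OF undef] by (simp add: CI_def)
    fix A assume "A \<in> sets (CI {0..<n})"
    then have A: "A \<in> sets (PiM {0..<n} (\<lambda>_. count_space UNIV))"
      by (simp add: CI_def)
    then show "emeasure (CI {0..<n}) A = emeasure (C 0 n (\<lambda>_. undefined)) A"
      using emeasure_CI[OF subset_refl A] sets.sets_into_space[OF A]
      by (simp add: space_PiM prod_emb_id)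
  qed
  finally show ?thesis .
qed

text \<open>The Markov property in integral form. The functional \<open>G\<close> may use the whole past up to time
  \<open>k + 1\<close>: the last coordinate is integrated out first, against the transition law from the
  position at time \<open>k\<close>. This holds because the marginal on \<open>k + 2\<close> coordinates is the bind of the marginal
  on \<open>k + 1\<close> coordinates with the kernel \<open>next_law\<close>.\<close>
lemma nn_integral_path_measure_step:
  fixes P :: "'a \<Rightarrow> 'a pmf"
  assumes G: "G \<in> borel_measurable (PiM {0..<Suc (Suc k)} (\<lambda>_. count_space UNIV))"
  shows "(\<integral>\<^sup>+\<omega>. G (restrict \<omega> {0..<Suc (Suc k)}) \<partial>path_measure P x) =
    (\<integral>\<^sup>+\<omega>. (\<integral>\<^sup>+y. G ((restrict \<omega> {0..<Suc k})(Suc k := y)) \<partial>P (\<omega> k)) \<partial>path_measure P x)"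
proof -
  define M :: "nat \<Rightarrow> 'a measure" where "M = (\<lambda>_. count_space UNIV)"
  interpret Ionescu_Tulcea "next_law P x" M
    unfolding M_def by (rule Ionescu_Tulcea_next_law)
  have undef: "(\<lambda>_. undefined) \<in> space (PiM {0..<0} M)"
    by (simp add: space_PiM)
  note G' [measurable] = G[folded M_def]
  have marginal: "(\<integral>\<^sup>+\<omega>. H (restrict \<omega> {0..<n}) \<partial>path_measure P x) = (\<integral>\<^sup>+\<omega>. H \<omega> \<partial>C 0 n (\<lambda>_. undefined))"
    if "H \<in> borel_measurable (PiM {0..<n} M)" for H n
  proof -
    have "(\<lambda>\<omega>. restrict \<omega> {0..<n}) \<in> measurable (path_measure P x) (PiM {0..<n} M)"
      unfolding M_def by measurable
    moreover have "C 0 n (\<lambda>_. undefined) = distr (path_measure P x) (PiM {0..<n} M) (\<lambda>\<omega>. restrict \<omega> {0..<n})"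
      unfolding M_def by (rule distr_path_measure_initial[symmetric])
    ultimately show ?thesis
      using that by (simp add: nn_integral_distr)
  qed
  have inner: "(\<integral>\<^sup>+\<eta>. G \<eta> \<partial>eP (Suc k) f) = (\<integral>\<^sup>+y. G (f(Suc k := y)) \<partial>P (f k))"
    if "f \<in> space (PiM {0..<Suc k} M)" for f
    using nn_integral_eP[OF that G'] by (simp add: next_law_def)
  have "(\<lambda>\<omega>. \<integral>\<^sup>+\<eta>. G \<eta> \<partial>eP (Suc k) \<omega>) \<in> borel_measurable (PiM {0..<Suc k} M)"
    by measurable
  then have inner_meas: "(\<lambda>f. \<integral>\<^sup>+y. G (f(Suc k := y)) \<partial>P (f k)) \<in> borel_measurable (PiM {0..<Suc k} M)"
    using inner by (simp cong: measurable_cong)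
  have "(\<integral>\<^sup>+\<omega>. G (restrict \<omega> {0..<Suc (Suc k)}) \<partial>path_measure P x) =
      (\<integral>\<^sup>+\<omega>. G \<omega> \<partial>C 0 (Suc (Suc k)) (\<lambda>_. undefined))"
    by (rule marginal) (rule G')
  also have "\<dots> = (\<integral>\<^sup>+\<omega>. G \<omega> \<partial>(C 0 (Suc k) (\<lambda>_. undefined) \<bind> eP (Suc k)))"
    by simp
  also have "\<dots> = (\<integral>\<^sup>+\<omega>. (\<integral>\<^sup>+\<eta>. G \<eta> \<partial>eP (Suc k) \<omega>) \<partial>C 0 (Suc k) (\<lambda>_. undefined))"
  proof (rule nn_integral_bind)
    show "G \<in> borel_measurable (PiM {0..<Suc (Suc k)} M)"
      by (rule G')
    show "eP (Suc k) \<in> measurable (C 0 (Suc k) (\<lambda>_. undefined)) (subprob_algebra (PiM {0..<Suc (Suc k)} M))"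
      using measurable_eP[of "Suc k"] by (subst measurable_cong_sets[OF sets_C[OF undef] refl]) simp
  qed
  also have "\<dots> = (\<integral>\<^sup>+f. (\<integral>\<^sup>+y. G (f(Suc k := y)) \<partial>P (f k)) \<partial>C 0 (Suc k) (\<lambda>_. undefined))"
    using space_C[OF undef, of "Suc k"] by (intro nn_integral_cong inner) simp
  also have "\<dots> = (\<integral>\<^sup>+\<omega>. (\<integral>\<^sup>+y. G ((restrict \<omega> {0..<Suc k})(Suc k := y)) \<partial>P (restrict \<omega> {0..<Suc k} k)) \<partial>path_measure P x)"
    by (rule marginal[symmetric]) (rule inner_meas)
  finally show ?thesis
    by simp
qed

lemma nn_integral_path_measure_Suc:
  "(\<integral>\<^sup>+\<omega>. g (\<omega> (Suc k)) \<partial>path_measure P x) = (\<integral>\<^sup>+\<omega>. (\<integral>\<^sup>+y. g y \<partial>P (\<omega> k)) \<partial>path_measure P x)"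
proof -
  have "(\<lambda>\<omega>. \<omega> (Suc k)) \<in> measurable (PiM {0..<Suc (Suc k)} (\<lambda>_. count_space UNIV)) (count_space UNIV)"
    by (rule measurable_component_singleton) simp
  then have "(\<lambda>\<omega>. g (\<omega> (Suc k))) \<in> borel_measurable (PiM {0..<Suc (Suc k)} (\<lambda>_. count_space UNIV))"
    by (rule measurable_compose) simp
  from nn_integral_path_measure_step[OF this, of P x] show ?thesis
    by simp
qed

section \<open>Criteria for finitely many visits and for infinitely many transitions\<close>

text \<open>A bounded superharmonic function that loses at least \<open>\<delta>\<close> on average whenever the walk
  is at \<open>y\<close> pays for all visits to \<open>y\<close>: along the trajectory its expectation
  decreases by at least \<open>\<delta>\<close> times the probability of being at \<open>y\<close>, so these probabilities
  have sum at most \<open>1 / \<delta>\<close>, and Borel-Cantelli applies.\<close>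
lemma AE_finite_visits_if_superharmonic:
  fixes P :: "'a \<Rightarrow> 'a pmf" and f :: "'a \<Rightarrow> ennreal" and \<delta> :: ennreal
  assumes bound: "\<And>z. f z \<le> 1" and "\<delta> > 0"
    and drop: "\<And>z. (\<integral>\<^sup>+z'. f z' \<partial>P z) + \<delta> * of_bool (z = y) \<le> f z"
  shows "AE \<omega> in path_measure P x. finite {n. \<omega> n = y}"
proof -
  let ?M = "path_measure P x"
  interpret prob_space ?M by (rule prob_space_path_measure)
  define A where "A k = {\<omega> \<in> space ?M. \<omega> k = y}" for k
  have A [measurable]: "A k \<in> sets ?M" for k
    unfolding A_def by measurable
  define a where "a k = (\<integral>\<^sup>+\<omega>. f (\<omega> k) \<partial>?M)" for k
  have step: "a (Suc k) + \<delta> * emeasure ?M (A k) \<le> a k" for k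
  proof -
    have "a (Suc k) + \<delta> * emeasure ?M (A k) =
        (\<integral>\<^sup>+\<omega>. (\<integral>\<^sup>+z'. f z' \<partial>P (\<omega> k)) \<partial>?M) + (\<integral>\<^sup>+\<omega>. \<delta> * indicator (A k) \<omega> \<partial>?M)"
      by (simp add: a_def nn_integral_path_measure_Suc nn_integral_cmult)
    also have "\<dots> = (\<integral>\<^sup>+\<omega>. (\<integral>\<^sup>+z'. f z' \<partial>P (\<omega> k)) + \<delta> * indicator (A k) \<omega> \<partial>?M)"
      by (intro nn_integral_add[symmetric]) measurable
    also have "\<dots> \<le> a k"
      unfolding a_def
    proof (rule nn_integral_mono)
      fix \<omega>
      show "(\<integral>\<^sup>+z'. f z' \<partial>P (\<omega> k)) + \<delta> * indicator (A k) \<omega> \<le> f (\<omega> k)"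
        using drop[of "\<omega> k"] by (simp add: A_def indicator_def)
    qed
    finally show ?thesis .
  qed
  have "a n + (\<Sum>k<n. \<delta> * emeasure ?M (A k)) \<le> a 0" for n
  proof (induction n)
    case (Suc n)
    have "a (Suc n) + (\<Sum>k<Suc n. \<delta> * emeasure ?M (A k)) =
        (a (Suc n) + \<delta> * emeasure ?M (A n)) + (\<Sum>k<n. \<delta> * emeasure ?M (A k))"
      by (simp add: algebra_simps)
    also have "\<dots> \<le> a n + (\<Sum>k<n. \<delta> * emeasure ?M (A k))"
      using step by (rule add_right_mono)
    also have "\<dots> \<le> a 0"
      by (rule Suc.IH)
    finally show ?case .
  qed simp
  moreover have "a 0 \<le> 1"
  proof -
    have "a 0 \<le> (\<integral>\<^sup>+\<omega>. 1 \<partial>?M)"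
      unfolding a_def using bound by (intro nn_integral_mono)
    then show ?thesis
      using emeasure_space_1 by simp
  qed
  ultimately have "(\<Sum>k<n. \<delta> * emeasure ?M (A k)) \<le> 1" for n
    by (metis add.commute order_trans le_iff_add)
  then have "(\<Sum>k. \<delta> * emeasure ?M (A k)) \<le> 1"
    by (intro suminf_le_const) auto
  then have "\<delta> * (\<Sum>k. emeasure ?M (A k)) \<le> 1"
    by simp
  then have "(\<Sum>k. emeasure ?M (A k)) \<noteq> \<infinity>"
    using \<open>\<delta> > 0\<close> by (auto simp: ennreal_mult_top top_unique split: if_splits)
  then have "(\<Sum>k. ennreal (prob (A k))) \<noteq> top"
    unfolding emeasure_eq_measure infinity_ennreal_def .
  then have "summable (\<lambda>k. prob (A k))"
    by (rule summable_suminf_not_top[OF measure_nonneg])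
  then have "AE \<omega> in ?M. eventually (\<lambda>k. \<omega> \<in> space ?M - A k) sequentially"
    by (intro borel_cantelli_AE1) (auto simp: emeasure_eq_measure)
  then show ?thesis
  proof (rule AE_mp, intro AE_I2 impI)
    fix \<omega> assume "eventually (\<lambda>k. \<omega> \<in> space ?M - A k) sequentially"
    then have "eventually (\<lambda>k. \<omega> k \<noteq> y) sequentially"
      by (rule eventually_mono) (simp add: A_def)
    then have "finite {k. \<not> \<omega> k \<noteq> y}"
      unfolding cofinite_eq_sequentially[symmetric] eventually_cofinite .
    then show "finite {k. \<omega> k = y}"
      by simp
  qed
qed

text \<open>The Markov operator with every transition that violates \<open>R\<close> killed. Its \<open>k\<close>-th power
  applied to the constant 1 is the probability that the first \<open>k\<close> steps all respect \<open>R\<close>.\<close>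
definition restricted_op :: "('a \<Rightarrow> 'a \<Rightarrow> bool) \<Rightarrow> ('a \<Rightarrow> 'a pmf) \<Rightarrow> ('a \<Rightarrow> ennreal) \<Rightarrow> 'a \<Rightarrow> ennreal" where
  "restricted_op R P g x = (\<integral>\<^sup>+y. of_bool (R x y) * g y \<partial>P x)"

lemma restricted_op_mono:
  "(\<And>y. f y \<le> g y) \<Longrightarrow> restricted_op R P f x \<le> restricted_op R P g x"
  unfolding restricted_op_def by (intro nn_integral_mono mult_left_mono) auto

lemma restricted_op_1_le_1: "restricted_op R P (\<lambda>_. 1) x \<le> 1"
proof -
  have "restricted_op R P (\<lambda>_. 1) x \<le> (\<integral>\<^sup>+y. 1 \<partial>P x)"
    unfolding restricted_op_def by (intro nn_integral_mono) auto
  then show ?thesis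
    by simp
qed

text \<open>Killing can only lose mass, and the operator is monotone; hence survival probabilities decrease
  in the number of steps.\<close>
lemma decseq_restricted_op_power: "decseq (\<lambda>k. (restricted_op R P ^^ k) (\<lambda>_. 1) x)"
proof (rule decseq_SucI)
  show "(restricted_op R P ^^ Suc k) (\<lambda>_. 1) x \<le> (restricted_op R P ^^ k) (\<lambda>_. 1) x" for k
  proof (induction k arbitrary: x)
    case 0
    then show ?case
      by (simp add: restricted_op_1_le_1)
  next
    case (Suc k)
    then show ?case
      unfolding funpow.simps(2)[of "Suc k"] funpow.simps(2)[of k "restricted_op R P"] o_apply
      by (intro restricted_op_mono) simp
  qed
qed

lemma restricted_op_power_le_1: "(restricted_op R P ^^ k) (\<lambda>_. 1) x \<le> 1"
  using decseqD[OF decseq_restricted_op_power, of 0 k R P x] by simp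

text \<open>Induction on \<open>j\<close>: the Markov property absorbs the last of the \<open>j\<close> steps into the
  test function \<open>g\<close>, which is therefore arbitrary. Countability of the state space makes the
  events \<open>R (\<omega> i) (\<omega> (Suc i))\<close> measurable for an arbitrary relation \<open>R\<close>.\<close>
lemma nn_integral_path_measure_restricted:
  fixes P :: "'a :: countable \<Rightarrow> 'a pmf"
  shows "(\<integral>\<^sup>+\<omega>. of_bool (\<forall>i<j. R (\<omega> (m + i)) (\<omega> (Suc (m + i)))) * g (\<omega> (m + j)) \<partial>path_measure P x) =
    (\<integral>\<^sup>+\<omega>. (restricted_op R P ^^ j) g (\<omega> m) \<partial>path_measure P x)"
proof (induction j arbitrary: g)
  case (Suc j)
  let ?n = "Suc (Suc (m + j))"
  let ?B = "\<lambda>\<omega> j. \<forall>i<j. R (\<omega> (m + i)) (\<omega> (Suc (m + i)))"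
  let ?G = "\<lambda>\<omega>. of_bool (?B \<omega> (Suc j)) * g (\<omega> (Suc (m + j)))"
  have coord: "(\<lambda>\<omega>. \<omega> i) \<in> measurable (PiM {0..<?n} (\<lambda>_. count_space UNIV)) (count_space UNIV)" if "i < ?n" for i
    by (rule measurable_component_singleton) (use that in simp)
  have "Measurable.pred (PiM {0..<?n} (\<lambda>_. count_space UNIV)) (\<lambda>\<omega>. R (\<omega> (m + i)) (\<omega> (Suc (m + i))))" if "i < Suc j" for i
  proof (rule measurable_compose_countable[where f = "\<lambda>z \<omega>. R z (\<omega> (Suc (m + i)))" and g = "\<lambda>\<omega>. \<omega> (m + i)"])
    show "Measurable.pred (PiM {0..<?n} (\<lambda>_. count_space UNIV)) (\<lambda>\<omega>. R z (\<omega> (Suc (m + i))))" for z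
      by (rule measurable_compose[OF coord]) (use that in auto)
  qed (use coord that in auto)
  then have [measurable]: "Measurable.pred (PiM {0..<?n} (\<lambda>_. count_space UNIV)) (\<lambda>\<omega>. ?B \<omega> (Suc j))"
    by (simp only: Ball_def[symmetric] lessThan_iff[symmetric]) (intro pred_intros_finite, auto)
  have [measurable]: "(\<lambda>\<omega>. g (\<omega> (Suc (m + j)))) \<in> borel_measurable (PiM {0..<?n} (\<lambda>_. count_space UNIV))"
    by (rule measurable_compose[OF coord]) auto
  have G: "?G \<in> borel_measurable (PiM {0..<?n} (\<lambda>_. count_space UNIV))"
    by measurable
  have "(\<integral>\<^sup>+\<omega>. ?G \<omega> \<partial>path_measure P x) = (\<integral>\<^sup>+\<omega>. ?G (restrict \<omega> {0..<?n}) \<partial>path_measure P x)"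
    by (intro nn_integral_cong) (auto simp: less_Suc_eq_le)
  also have "\<dots> = (\<integral>\<^sup>+\<omega>. (\<integral>\<^sup>+y. ?G ((restrict \<omega> {0..<Suc (m + j)})(Suc (m + j) := y)) \<partial>P (\<omega> (m + j))) \<partial>path_measure P x)"
    by (rule nn_integral_path_measure_step[OF G])
  also have "\<dots> = (\<integral>\<^sup>+\<omega>. of_bool (?B \<omega> j) * restricted_op R P g (\<omega> (m + j)) \<partial>path_measure P x)"
  proof (rule nn_integral_cong)
    fix \<omega> :: "nat \<Rightarrow> 'a"
    have "?G ((restrict \<omega> {0..<Suc (m + j)})(Suc (m + j) := y)) = of_bool (?B \<omega> j) * (of_bool (R (\<omega> (m + j)) y) * g y)" for y
      by (auto simp: All_less_Suc)
    then show "(\<integral>\<^sup>+y. ?G ((restrict \<omega> {0..<Suc (m + j)})(Suc (m + j) := y)) \<partial>P (\<omega> (m + j))) =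
        of_bool (?B \<omega> j) * restricted_op R P g (\<omega> (m + j))"
      by (simp add: restricted_op_def nn_integral_cmult)
  qed
  also have "\<dots> = (\<integral>\<^sup>+\<omega>. (restricted_op R P ^^ j) (restricted_op R P g) (\<omega> m) \<partial>path_measure P x)"
    by (rule Suc.IH)
  finally show ?case
    by (simp add: funpow_swap1)
qed simp

text \<open>By the Markov property the probability that \<open>R\<close> is respected for \<open>k\<close> steps from time \<open>m\<close> on
  is the expected survival probability from the random position at time \<open>m\<close>. If survival
  probabilities vanish pointwise, dominated convergence lets this tend to 0; it remains to take the
  countable union over \<open>m\<close>.\<close>
lemma AE_infinitely_often_not_if_restricted_vanishes:
  fixes P :: "'a :: countable \<Rightarrow> 'a pmf"
  assumes lim: "\<And>z. (\<lambda>k. (restricted_op R P ^^ k) (\<lambda>_. 1) z) \<longlonglongrightarrow> 0"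
  shows "AE \<omega> in path_measure P x. \<exists>\<^sub>\<infinity>k. \<not> R (\<omega> k) (\<omega> (Suc k))"
proof -
  let ?M = "path_measure P x" and ?Q = "restricted_op R P"
  interpret prob_space ?M by (rule prob_space_path_measure)
  have R [measurable]: "Measurable.pred ?M (\<lambda>\<omega>. R (\<omega> i) (\<omega> j))" for i j
    by (rule measurable_compose_countable[where f = "\<lambda>z \<omega>. R z (\<omega> j)"]) measurable
  have "AE \<omega> in ?M. \<not> (\<forall>i. R (\<omega> (m + i)) (\<omega> (Suc (m + i))))" for m
  proof -
    let ?E = "\<lambda>\<omega> k. \<forall>i<k. R (\<omega> (m + i)) (\<omega> (Suc (m + i)))"
    let ?N = "{\<omega> \<in> space ?M. \<forall>i. R (\<omega> (m + i)) (\<omega> (Suc (m + i)))}"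
    have "emeasure ?M ?N \<le> (\<integral>\<^sup>+\<omega>. (?Q ^^ k) (\<lambda>_. 1) (\<omega> m) \<partial>?M)" for k
    proof -
      have "emeasure ?M ?N = (\<integral>\<^sup>+\<omega>. indicator ?N \<omega> \<partial>?M)"
        by (intro nn_integral_indicator[symmetric]) measurable
      also have "\<dots> \<le> (\<integral>\<^sup>+\<omega>. of_bool (?E \<omega> k) * 1 \<partial>?M)"
        by (intro nn_integral_mono) (auto simp: indicator_def)
      also have "\<dots> = (\<integral>\<^sup>+\<omega>. (?Q ^^ k) (\<lambda>_. 1) (\<omega> m) \<partial>?M)"
        by (rule nn_integral_path_measure_restricted)
      finally show ?thesis .
    qed
    moreover have "(\<lambda>k. \<integral>\<^sup>+\<omega>. (?Q ^^ k) (\<lambda>_. 1) (\<omega> m) \<partial>?M) \<longlonglongrightarrow> (\<integral>\<^sup>+\<omega>. 0 \<partial>?M)"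
      by (rule nn_integral_dominated_convergence[where w = "\<lambda>_. 1"])
         (use lim emeasure_space_1 in \<open>auto intro: restricted_op_power_le_1\<close>)
    ultimately have "emeasure ?M ?N \<le> 0"
      by (intro LIMSEQ_le_const) auto
    moreover have "?N \<in> sets ?M"
      by measurable
    ultimately have "?N \<in> null_sets ?M"
      by (simp add: null_sets_def)
    then show ?thesis
      by (rule AE_I') auto
  qed
  then have "AE \<omega> in ?M. \<forall>m. \<not> (\<forall>i. R (\<omega> (m + i)) (\<omega> (Suc (m + i))))"
    by (simp add: AE_all_countable)
  then show ?thesis
  proof (rule AE_mp, intro AE_I2 impI)
    fix \<omega> assume *: "\<forall>m. \<not> (\<forall>i. R (\<omega> (m + i)) (\<omega> (Suc (m + i))))"
    show "\<exists>\<^sub>\<infinity>k. \<not> R (\<omega> k) (\<omega> (Suc k))"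
      unfolding INFM_nat_le using * by (metis le_add1)
  qed
qed

section \<open>Convex sequences\<close>

text \<open>A discrete comparison argument for \<open>w'' \<ge> q w\<close>. A nonnegative solution with \<open>w 0 = 0\<close>
  is convex, so if it is positive somewhere it grows at least linearly, \<open>w j \<ge> c j\<close>. Then the slope
  grows by at least \<open>c j q j\<close> at step \<open>j\<close>, and tends to infinity when the sum of \<open>j q j\<close>
  diverges; but a convex sequence of at most linear growth has bounded slope.\<close>
lemma convex_sequence_forced_zero:
  fixes w q :: "nat \<Rightarrow> real"
  assumes w0: "w 0 = 0" and nonneg: "\<And>j. 0 \<le> w j" and bound: "\<And>j. w j \<le> C * (real j + 1)"
    and q: "\<And>j. 0 \<le> q j"
    and convex: "\<And>j. w (Suc (Suc j)) - 2 * w (Suc j) + w j \<ge> q (Suc j) * w (Suc j)"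
    and diverges: "\<not> summable (\<lambda>j. real j * q j)"
  shows "w j = 0"
proof (rule ccontr)
  define m where "m = j"
  assume "w j \<noteq> 0"
  then have wm: "w m > 0"
    using nonneg[of m] by (simp add: m_def)
  then have m: "m > 0"
    using w0 by (cases m) auto
  define d where "d j = w (Suc j) - w j" for j
  define c where "c = w m / real m"
  have c: "c > 0"
    using wm m by (simp add: c_def)
  have d_step: "d (Suc j) \<ge> d j + q (Suc j) * w (Suc j)" for j
    using convex[of j] by (simp add: d_def)
  then have "d j \<le> d (Suc j)" for j
    using mult_nonneg_nonneg[OF q[of "Suc j"] nonneg[of "Suc j"]] by (smt (verit))
  then have "incseq d"
    by (rule incseq_SucI)
  then have d_mono: "d i \<le> d j" if "i \<le> j" for i j
    using that by (rule incseqD)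
  have d_nonneg: "0 \<le> d j" for j
    using d_mono[of 0 j] nonneg[of 1] w0 by (simp add: d_def)
  \<comment> \<open>A slope above \<open>C\<close> would persist by convexity and eventually violate the linear bound.\<close>
  have d_le: "d M \<le> C" for M
  proof (rule ccontr)
    assume "\<not> d M \<le> C"
    then have "d M - C > 0" by simp
    then obtain n where n: "C * (real M + 1) < real n * (d M - C)"
      using reals_Archimedean3 by blast
    have "w (M + n) \<ge> real n * d M"
    proof (induction n)
      case (Suc n)
      have "w (M + Suc n) = w (M + n) + d (M + n)"
        by (simp add: d_def)
      also have "\<dots> \<ge> real n * d M + d M"
        using Suc.IH d_mono[of M "M + n"] by simp
      finally show ?case
        by (simp add: algebra_simps)
    qed (simp add: nonneg)
    with bound[of "M + n"] n show False
      by (simp add: algebra_simps)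
  qed
  \<comment> \<open>The chord from the origin is less steep than the next increment; so \<open>w j / j\<close> is nondecreasing.\<close>
  have chord: "w j \<le> real j * d j" for j
  proof (induction j)
    case (Suc j)
    have "w (Suc j) \<le> real (Suc j) * d j"
      using Suc.IH by (simp add: d_def algebra_simps)
    also have "\<dots> \<le> real (Suc j) * d (Suc j)"
      by (intro mult_left_mono d_mono) auto
    finally show ?case .
  qed (simp add: w0)
  have linear: "c * real j \<le> w j" if "m \<le> j" for j
    using that
  proof (induction j rule: dec_induct)
    case base
    then show ?case using m by (simp add: c_def)
  next
    case (step j)
    then have "real j > 0" using m by simp
    have "real j * c \<le> real j * d j"
      using step.IH chord[of j] by (simp add: mult.commute)
    then have "c \<le> d j"
      using \<open>real j > 0\<close> by simp
    then show ?case
      using step.IH by (simp add: d_def algebra_simps)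
  qed
  have "summable (\<lambda>i. c * (real (i + Suc m) * q (i + Suc m)))"
  proof (rule summableI_nonneg_bounded)
    show "0 \<le> c * (real (n + Suc m) * q (n + Suc m))" for n
      using c q by simp
    have "(\<Sum>i<n. c * (real (i + Suc m) * q (i + Suc m))) \<le> d (m + n)" for n
    proof (induction n)
      case (Suc n)
      have "q (Suc (m + n)) * (c * real (Suc (m + n))) \<le> q (Suc (m + n)) * w (Suc (m + n))"
        by (intro mult_left_mono linear q) simp
      with d_step[of "m + n"] Suc.IH show ?case
        by (simp add: algebra_simps)
    qed (simp add: d_nonneg)
    then show "(\<Sum>i<n. c * (real (i + Suc m) * q (i + Suc m))) \<le> C" for n
      using d_le order_trans by blast
  qed
  then have "summable (\<lambda>i. real (i + Suc m) * q (i + Suc m))"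
    by (rule summable_mult_D) (use c in simp)
  then have "summable (\<lambda>j. real j * q j)"
    by (rule summable_iff_shift[THEN iffD1])
  with diverges show False ..
qed

section \<open>Laws with prescribed tails\<close>

lemma pmf_with_tails:
  fixes T :: "nat \<Rightarrow> real"
  assumes T0: "T 0 = 1" and dec: "decseq T" and lim: "T \<longlonglongrightarrow> 0"
  obtains \<sigma> where "\<And>n. measure_pmf.prob \<sigma> {n..} = T n" "\<And>n. pmf \<sigma> n = T n - T (Suc n)"
proof -
  have nonneg: "0 \<le> T n - T (Suc n)" for n
    using decseq_SucD[OF dec, of n] by simp
  have "(\<lambda>n. T n - T (Suc n)) sums (T 0 - 0)"
    using lim by (rule telescope_sums')
  then have sums: "(\<lambda>n. T n - T (Suc n)) sums 1"
    by (simp add: T0)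
  have "(\<integral>\<^sup>+n. ennreal (T n - T (Suc n)) \<partial>count_space UNIV) = (\<Sum>n. ennreal (T n - T (Suc n)))"
    by (rule nn_integral_count_space_nat)
  also have "\<dots> = ennreal 1"
    using nonneg sums by (simp add: suminf_ennreal2 sums_iff)
  finally have total: "(\<integral>\<^sup>+n. ennreal (T n - T (Suc n)) \<partial>count_space UNIV) = 1"
    by simp
  define \<sigma> where "\<sigma> = embed_pmf (\<lambda>n. T n - T (Suc n))"
  have pmf: "pmf \<sigma> n = T n - T (Suc n)" for n
    unfolding \<sigma>_def by (rule pmf_embed_pmf[OF nonneg total])
  have "measure_pmf.prob \<sigma> {n..} = T n" for n
  proof -
    have "measure_pmf.prob \<sigma> {n..} = 1 - measure_pmf.prob \<sigma> {..<n}"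
      using measure_pmf.prob_compl[of "{..<n}" \<sigma>] by (simp add: Compl_eq_Diff_UNIV[symmetric])
    also have "measure_pmf.prob \<sigma> {..<n} = (\<Sum>i<n. pmf \<sigma> i)"
      by (rule measure_measure_pmf_finite) simp
    also have "\<dots> = 1 - T n"
      unfolding pmf by (simp add: sum_lessThan_telescope' T0)
    finally show ?thesis
      by simp
  qed
  with pmf show thesis
    using that by blast
qed

text \<open>Summation by parts: the mean of a law on the naturals is the sum of its
  tail probabilities from 1 on.\<close>
lemma summable_mean_if_summable_tails:
  fixes T :: "nat \<Rightarrow> real"
  assumes dec: "decseq T" and nonneg: "\<And>n. 0 \<le> T n" and "summable T"
  shows "summable (\<lambda>n. real n * (T n - T (Suc n)))"
proof (rule summableI_nonneg_bounded)
  show "0 \<le> real n * (T n - T (Suc n))" for n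
    using decseq_SucD[OF dec, of n] by simp
  fix n
  have "(\<Sum>i<n. real i * (T i - T (Suc i))) + real n * T n \<le> (\<Sum>i<Suc n. T i)"
  proof (induction n)
    case (Suc n)
    then show ?case
      by (simp add: algebra_simps)
  qed (simp add: nonneg)
  also have "\<dots> \<le> suminf T"
    using \<open>summable T\<close> nonneg by (intro sum_le_suminf) auto
  finally show "(\<Sum>i<n. real i * (T i - T (Suc i))) \<le> suminf T"
    using mult_nonneg_nonneg[OF of_nat_0_le_iff nonneg, of n n] by linarith
qed

section \<open>The integer line and its ends\<close>

lemma awalk_int_line_exists:
  "\<exists>p. pre_digraph.awalk (with_proj int_line) x p y \<and> length p = nat \<bar>x - y\<bar>"
proof (induction "nat \<bar>x - y\<bar>" arbitrary: x)
  case 0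
  then show ?case
    by (intro exI[of _ "[]"]) (auto simp: pre_digraph.awalk_def int_line_def cas_with_proj_eq)
next
  case (Suc n)
  define x' where "x' = (if x < y then x + 1 else x - 1)"
  have x': "n = nat \<bar>x' - y\<bar>" "\<bar>x - x'\<bar> = 1"
    using Suc(2) by (auto simp: x'_def)
  from Suc(1)[OF x'(1)] obtain p where p: "pre_digraph.awalk (with_proj int_line) x' p y" "length p = n"
    using x'(1) by auto
  have "pre_digraph.awalk (with_proj int_line) x ((x, x') # p) y"
    using p(1) x'(2) by (auto simp: pre_digraph.awalk_def cas_with_proj_eq int_line_def)
  with p(2) Suc(2) show ?case
    by (intro exI[of _ "(x, x') # p"]) simp
qed

lemma gdist_int_line_le: "gdist int_line x y \<le> nat \<bar>x - y\<bar>"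
  unfolding gdist_def by (rule Least_le) (rule awalk_int_line_exists)

lemma loc_finite_graph_int_line: "loc_finite_graph int_line"
proof -
  interpret pair_bidirected_digraph int_line
    by unfold_locales (auto simp: int_line_def symmetric_def sym_def arcs_ends_conv)
  have "Digraph_Component.connected (with_proj int_line)"
    unfolding Digraph_Component.connected_def
  proof (rule strongly_connectedI)
    show "verts (with_proj (mk_symmetric (with_proj int_line))) \<noteq> {}"
      by (simp add: mk_symmetric_def int_line_def)
    fix u v
    obtain p where "awalk u p v"
      using awalk_int_line_exists by auto
    then have "u \<rightarrow>\<^sup>*\<^bsub>with_proj int_line\<^esub> v"
      by (rule reachable_awalkI)
    then show "u \<rightarrow>\<^sup>*\<^bsub>with_proj (mk_symmetric (with_proj int_line))\<^esub> v"
      by (rule reachable_mk_symmetricI)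
  qed
  moreover have "finite {y. (x, y) \<in> parcs int_line}" for x
    by (rule finite_subset[of _ "{x - 1, x + 1}"]) (auto simp: int_line_def)
  moreover have "pair_bidirected_digraph int_line" ..
  ultimately show ?thesis
    unfolding loc_finite_graph_def by blast
qed

text \<open>Once the origin is deleted, neighbours have the same sign. So a component of the complement of
  the origin lies on one side of it, and this is all that has to be known about ends here.\<close>
lemma comps_off_zero_same_sign:
  assumes S: "S \<in> comps_off int_line {0}" and "a \<in> S" "b \<in> S"
  shows "sgn1 a = sgn1 b"
proof -
  let ?H = "with_proj int_line \<restriction> (pverts int_line - {0})"
  have "a \<rightarrow>\<^sup>*\<^bsub>?H\<^esub> b"
    using assms unfolding comps_off_def pre_digraph.sccs_verts_def by blast
  then have "(a, b) \<in> rtrancl_on (verts ?H) (arcs_ends ?H)"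
    by (simp add: reachable_def)
  then show ?thesis
  proof (induction rule: rtrancl_on_induct)
    case (step y z)
    then have "\<bar>y - z\<bar> = 1" "y \<noteq> 0" "z \<noteq> 0"
      by (auto simp: arcs_ends_conv induce_subgraph_def int_line_def)
    then have "sgn1 y = sgn1 z"
      by (auto simp: sgn1_def)
    with step show ?case by simp
  qed simp
qed

text \<open>Tested on the finite set \<open>{0}\<close>, convergence to an end keeps the trajectory eventually in
  one component, hence eventually on one side of the origin.\<close>
lemma not_converges_to_end_if_sign_alternates:
  assumes U: "U \<in> end_space int_line" and conv: "converges_to_end int_line \<omega> U"
    and changes: "\<exists>\<^sub>\<infinity>k. \<not> sgn1 (\<omega> k) = sgn1 (\<omega> (Suc k))"
  shows False
proof -
  have comp: "U {0} \<in> comps_off int_line {0}"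
    using U by (auto simp: end_space_def int_line_def)
  have ev: "\<forall>\<^sub>F n in sequentially. \<omega> n \<in> U {0}"
    using conv by (simp add: converges_to_end_def int_line_def)
  then have "\<forall>\<^sub>F n in sequentially. \<omega> (Suc n) \<in> U {0}"
    by (rule eventually_sequentially_Suc[THEN iffD2])
  with ev have "\<forall>\<^sub>F n in sequentially. sgn1 (\<omega> n) = sgn1 (\<omega> (Suc n))"
    by eventually_elim (rule comps_off_zero_same_sign[OF comp])
  then show False
    using changes by (simp add: frequently_def cofinite_eq_sequentially)
qed

section \<open>The reflected walk\<close>

text \<open>The reflection rate behaves like \<open>1 / n\<^sup>2\<close>, an order of decay for which the tails
  of the jump sizes are summable while \<open>n * reflection_rate n\<close>, of order \<open>1 / n\<close>, is not.
  It vanishes at 0, where reflection would mean standing still.\<close>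
definition reflection_rate :: "nat \<Rightarrow> real" where
  "reflection_rate n = real n / (real n + 1) ^ 3"

text \<open>With this drift and no reflection the absolute value of the walk steps from \<open>n\<close> to \<open>n + 1\<close>
  with probability \<open>(n + 2) / (2 (n + 1))\<close>. This is simple random walk conditioned never to hit \<open>-1\<close>
  (Doob transform by \<open>n + 1\<close>), the discrete three-dimensional Bessel process. Multiplication by
  \<open>n + 1\<close> turns its generator back into a second difference.\<close>
definition outward_drift :: "nat \<Rightarrow> real" where
  "outward_drift n = 1 / (real n + 1)"

abbreviation reflected_walk :: "int \<Rightarrow> int pmf" where
  "reflected_walk \<equiv> flip_chain reflection_rate outward_drift"

lemma reflection_rate_nonneg: "0 \<le> reflection_rate n"
  by (simp add: reflection_rate_def)

lemma reflection_rate_0: "reflection_rate 0 = 0"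
  by (simp add: reflection_rate_def)

lemma reflection_rate_le_inverse_square: "reflection_rate n \<le> 1 / (real n + 1)\<^sup>2"
  by (simp add: reflection_rate_def divide_simps power2_eq_square power3_eq_cube)

lemma reflection_rate_le_half: "reflection_rate n \<le> 1 / 2"
proof -
  have "2 * real n \<le> (real n + 1) ^ 3"
    by (simp add: power3_eq_cube algebra_simps)
  then show ?thesis
    by (simp add: reflection_rate_def divide_simps)
qed

lemma flip_params_reflected_walk: "flip_params reflection_rate outward_drift"
proof -
  have "reflection_rate n \<le> 1" for n
    using reflection_rate_le_half[of n] by linarith
  then show ?thesis
    by (simp add: flip_params_def reflection_rate_nonneg outward_drift_def)
qed

lemma nn_integral_flip_chain:
  fixes x :: int and f :: "int \<Rightarrow> ennreal"
  assumes params: "flip_params p \<epsilon>" and n: "n = nat \<bar>x\<bar>"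
  shows "(\<integral>\<^sup>+y. f y \<partial>flip_chain p \<epsilon> x) =
    ennreal ((1 - p n) * ((1 + \<epsilon> n) / 2)) * f (sgn1 x * (\<bar>x\<bar> + 1)) +
    ennreal ((1 - p n) * ((1 - \<epsilon> n) / 2)) * f (sgn1 x * (\<bar>x\<bar> - 1)) +
    ennreal (p n) * f (- x)"
proof -
  let ?a = "sgn1 x * (\<bar>x\<bar> + 1)" and ?b = "sgn1 x * (\<bar>x\<bar> - 1)"
  have distinct: "?a \<noteq> ?b" "?a \<noteq> - x" "?b \<noteq> - x"
    unfolding sgn1_def by presburger+
  have supp: "y \<in> {?a, ?b, - x}" if "y \<in> set_pmf (flip_chain p \<epsilon> x)" for y
    using that by (auto simp: set_pmf_iff pmf_flip_chain[OF params] flip_prob_def Let_def split: if_splits)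
  have "(\<integral>\<^sup>+y. f y \<partial>flip_chain p \<epsilon> x) = (\<Sum>y\<in>{?a, ?b, - x}. f y * ennreal (pmf (flip_chain p \<epsilon> x) y))"
    by (rule nn_integral_measure_pmf_support) (use supp in auto)
  also have "\<dots> = f ?a * ennreal (flip_prob p \<epsilon> x ?a) + (f ?b * ennreal (flip_prob p \<epsilon> x ?b) + f (- x) * ennreal (flip_prob p \<epsilon> x (- x)))"
    using distinct by (simp add: pmf_flip_chain[OF params])
  also have "\<dots> = ennreal ((1 - p n) * ((1 + \<epsilon> n) / 2)) * f ?a +
      ennreal ((1 - p n) * ((1 - \<epsilon> n) / 2)) * f ?b + ennreal (p n) * f (- x)"
    using distinct by (simp add: flip_prob_def Let_def n mult.commute add.assoc)
  finally show ?thesis .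
qed

section \<open>Transience, irreducibility and moments\<close>

text \<open>Without reflection \<open>1 / (n + 1)\<close> is harmonic away from the origin. Its concave image \<open>1 / (n + 2)\<close>
  is strictly superharmonic at every \<open>n\<close>, with the explicit defect in the last summand; as
  reflections do not change the absolute value, they only scale this defect by \<open>1 - p\<close>.\<close>
lemma radial_potential_drop:
  fixes n p :: real
  assumes "n \<ge> 0"
  shows "(1 - p) * ((1 + 1 / (n + 1)) / 2) * (1 / (n + 3)) + (1 - p) * ((1 - 1 / (n + 1)) / 2) * (1 / (n + 1)) + p * (1 / (n + 2))
    + (1 - p) / ((n + 1)\<^sup>2 * (n + 2) * (n + 3)) = 1 / (n + 2)"
proof -
  have nz: "n + 1 \<noteq> 0" "n + 2 \<noteq> 0" "n + 3 \<noteq> 0"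
    using assms by auto
  have "((1 + 1 / (n + 1)) / 2) * (1 / (n + 3)) + ((1 - 1 / (n + 1)) / 2) * (1 / (n + 1))
      + 1 / ((n + 1)\<^sup>2 * (n + 2) * (n + 3)) = 1 / (n + 2)"
    using nz by (simp add: divide_simps power2_eq_square) algebra
  then have "(1 - p) * (((1 + 1 / (n + 1)) / 2) * (1 / (n + 3)) + ((1 - 1 / (n + 1)) / 2) * (1 / (n + 1))
      + 1 / ((n + 1)\<^sup>2 * (n + 2) * (n + 3))) + p * (1 / (n + 2)) = 1 / (n + 2)"
    by (simp add: algebra_simps diff_divide_distrib)
  then show ?thesis
    by (simp add: distrib_left mult.assoc)
qed

lemma transient_reflected_walk: "transient_walk int_line reflected_walk"
  unfolding transient_walk_def
proof (intro ballI)
  fix x y :: int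
  define drop where "drop n = (1 - reflection_rate n) / ((real n + 1)\<^sup>2 * (real n + 2) * (real n + 3))" for n
  have drop_pos: "drop n > 0" for n
    using reflection_rate_le_half[of n] unfolding drop_def by (intro divide_pos_pos mult_pos_pos) auto
  let ?f = "\<lambda>z :: int. ennreal (1 / (real_of_int \<bar>z\<bar> + 2))"
  show "AE \<omega> in path_measure reflected_walk x. finite {n. \<omega> n = y}"
  proof (rule AE_finite_visits_if_superharmonic)
    show "?f z \<le> 1" for z
      by (simp add: divide_simps)
    show "ennreal (drop (nat \<bar>y\<bar>)) > 0"
      using drop_pos by simp
    fix z :: int
    define n where "n = nat \<bar>z\<bar>"
    let ?p = "reflection_rate n" and ?up = "(1 - reflection_rate n) * ((1 + outward_drift n) / 2)"
      and ?down = "(1 - reflection_rate n) * ((1 - outward_drift n) / 2)"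
    have nonneg: "0 \<le> ?p" "0 \<le> ?up" "0 \<le> ?down"
      using flip_params_reflected_walk by (auto simp: flip_params_def)
    have absz: "\<bar>z\<bar> = int n"
      by (simp add: n_def)
    have f_up: "?f (sgn1 z * (\<bar>z\<bar> + 1)) = ennreal (1 / (real n + 3))"
      by (simp add: absz sgn1_def abs_mult add.commute)
    \<comment> \<open>At the origin the inward neighbour has absolute value 1 instead of \<open>n - 1\<close>, but is reached with probability 0.\<close>
    have f_down: "ennreal ?down * ?f (sgn1 z * (\<bar>z\<bar> - 1)) = ennreal (?down * (1 / (real n + 1)))"
    proof (cases n)
      case 0
      then show ?thesis
        by (simp add: outward_drift_def)
    next
      case (Suc m)
      then have "?f (sgn1 z * (\<bar>z\<bar> - 1)) = ennreal (1 / (real n + 1))"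
        by (simp add: absz sgn1_def abs_mult)
      then show ?thesis
        using nonneg by (simp only: ennreal_mult'[symmetric])
    qed
    have f_flip: "?f (- z) = ennreal (1 / (real n + 2))"
      by (simp add: absz)
    have "(\<integral>\<^sup>+z'. ?f z' \<partial>reflected_walk z) + ennreal (drop (nat \<bar>y\<bar>)) * of_bool (z = y) \<le>
        (\<integral>\<^sup>+z'. ?f z' \<partial>reflected_walk z) + ennreal (drop n)"
      by (auto simp: n_def)
    also have "\<dots> = ennreal (?up * (1 / (real n + 3)) + ?down * (1 / (real n + 1)) + ?p * (1 / (real n + 2)) + drop n)"
      unfolding nn_integral_flip_chain[OF flip_params_reflected_walk n_def] f_up f_down f_flip
      using nonneg drop_pos[of n]
      by (subst ennreal_mult'[symmetric] ennreal_plus[symmetric];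
          (intro add_nonneg_nonneg mult_nonneg_nonneg)?; simp)+
    also have "?up * (1 / (real n + 3)) + ?down * (1 / (real n + 1)) + ?p * (1 / (real n + 2)) + drop n = 1 / (real n + 2)"
      unfolding drop_def outward_drift_def by (rule radial_potential_drop) simp
    also have "ennreal \<dots> = ?f z"
      by (simp add: absz)
    finally show "(\<integral>\<^sup>+z'. ?f z' \<partial>reflected_walk z) + ennreal (drop (nat \<bar>y\<bar>)) * of_bool (z = y) \<le> ?f z" .
  qed
qed

text \<open>All edges are used in one step with probability at least 1/8, except for the edge from \<open>0\<close> to
  \<open>-1\<close>: as the drift at the origin is 1, the walk first moves to \<open>1\<close> and is then reflected.\<close>
lemma uniformly_irreducible_reflected_walk: "uniformly_irreducible int_line reflected_walk"
  unfolding uniformly_irreducible_def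
proof (intro exI[of _ "1/8 :: real"] exI[of _ "2 :: nat"] conjI ballI; (clarify)?)
  fix x y assume "(x, y) \<in> parcs int_line"
  then have xy: "\<bar>x - y\<bar> = 1"
    by (simp add: int_line_def)
  define n where "n = nat \<bar>x\<bar>"
  note pmf_walk = pmf_flip_chain[OF flip_params_reflected_walk]
  have one_step: "kstep reflected_walk (Suc 0) = reflected_walk"
  proof -
    have "kstep reflected_walk 0 = return_pmf"
      by (simp add: fun_eq_iff)
    then show ?thesis
      by (intro ext) (simp only: kstep.simps(2) bind_return_pmf')
  qed
  have half: "1 / 2 \<le> 1 - reflection_rate n"
    using reflection_rate_le_half[of n] by simp
  have "y = sgn1 x * (\<bar>x\<bar> + 1) \<or> y = sgn1 x * (\<bar>x\<bar> - 1) \<and> x \<noteq> 0 \<or> x = 0 \<and> y = - 1"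
    using xy unfolding sgn1_def by presburger
  then consider "y = sgn1 x * (\<bar>x\<bar> + 1)" | "y = sgn1 x * (\<bar>x\<bar> - 1)" "x \<noteq> 0" | "x = 0" "y = - 1"
    by blast
  then show "\<exists>k\<le>2. 1 / 8 \<le> pmf (kstep reflected_walk k x) y"
  proof cases
    case 1
    have "(1 / 2) * (1 / 2) \<le> (1 - reflection_rate n) * ((1 + outward_drift n) / 2)"
      using half by (intro mult_mono) (auto simp: outward_drift_def)
    with 1 show ?thesis
      by (intro exI[of _ "Suc 0"]) (simp del: kstep.simps add: one_step pmf_walk flip_prob_def Let_def n_def)
  next
    case 2
    then have "n \<ge> 1"
      by (simp add: n_def)
    then have "(1 / 2) * (1 / 4) \<le> (1 - reflection_rate n) * ((1 - outward_drift n) / 2)"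
      using half by (intro mult_mono) (auto simp: outward_drift_def divide_simps)
    with 2 show ?thesis
      by (intro exI[of _ "Suc 0"]) (auto simp del: kstep.simps simp: mult_ac one_step pmf_walk flip_prob_def Let_def n_def sgn1_def split: if_splits)
  next
    case 3
    have "reflected_walk 0 = return_pmf 1"
      by (rule pmf_eqI) (auto simp: pmf_walk flip_prob_def Let_def sgn1_def reflection_rate_0 outward_drift_def indicator_def)
    then have "kstep reflected_walk 2 0 = reflected_walk 1"
      unfolding numeral_2_eq_2 kstep.simps(2)[of _ "Suc 0"] one_step by (simp add: bind_return_pmf)
    with 3 show ?thesis
      by (intro exI[of _ 2]) (simp add: pmf_walk flip_prob_def Let_def sgn1_def reflection_rate_def)
  qed
qed simp

text \<open>Steps of length at least 2 are reflections. From \<open>x\<close> with \<open>\<bar>x\<bar> = N\<close> they have length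
  \<open>2 N\<close> and probability at most \<open>1 / (N + 1)\<^sup>2\<close>, so the tails of all step laws are
  dominated by \<open>4 / (n + 1)\<^sup>2\<close>, which is summable. The value of the majorant at 1 is exactly 1, as
  required by the steps of length 1.\<close>
lemma uniform_first_moment_reflected_walk: "uniform_first_moment int_line reflected_walk"
proof -
  define T :: "nat \<Rightarrow> real" where "T n = min 1 (4 / (real n + 1)\<^sup>2)" for n
  have T_nonneg: "0 \<le> T n" for n
    by (simp add: T_def)
  have dec: "decseq T"
    unfolding T_def by (intro decseq_SucI min.mono divide_left_mono power_mono mult_pos_pos) auto
  have "summable (\<lambda>n. 1 / (real (Suc n))\<^sup>2)"
    using inverse_power_summable[of 2, where 'a = real] by (subst summable_Suc_iff) (simp add: divide_inverse)
  then have "summable (\<lambda>n. 4 * (1 / (real (Suc n))\<^sup>2))"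
    by (rule summable_mult)
  then have sum: "summable T"
    by (rule summable_comparison_test') (simp add: T_def add.commute)
  then have lim: "T \<longlonglongrightarrow> 0"
    by (rule summable_LIMSEQ_zero)
  have T0: "T 0 = 1"
    by (simp add: T_def)
  obtain \<sigma> where tails: "\<And>n. measure_pmf.prob \<sigma> {n..} = T n" and pmf: "\<And>n. pmf \<sigma> n = T n - T (Suc n)"
    by (rule pmf_with_tails[OF T0 dec lim]) blast
  have "steps_tight_with int_line reflected_walk \<sigma>"
    unfolding steps_tight_with_def
  proof (intro ballI allI)
    fix x :: int and n :: nat
    define N where "N = nat \<bar>x\<bar>"
    have "measure_pmf.prob (reflected_walk x) {y. n \<le> gdist int_line x y} \<le> T n"
    proof (cases "n \<le> 1")
      case True
      then have "T n = 1"
        by (cases n) (auto simp: T_def)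
      then show ?thesis
        by simp
    next
      case False
      have flip: "y = - x \<and> n \<le> 2 * N" if "y \<in> set_pmf (reflected_walk x)" "n \<le> gdist int_line x y" for y
      proof -
        have far: "n \<le> nat \<bar>x - y\<bar>"
          using that(2) gdist_int_line_le[of x y] by simp
        have "y \<in> {sgn1 x * (\<bar>x\<bar> + 1), sgn1 x * (\<bar>x\<bar> - 1), - x}"
          using that(1) by (auto simp: set_pmf_iff pmf_flip_chain[OF flip_params_reflected_walk] flip_prob_def Let_def split: if_splits)
        then show ?thesis
          using far False by (auto simp: N_def sgn1_def split: if_splits)
      qed
      show ?thesis
      proof (cases "n \<le> 2 * N")
        case True
        have "measure_pmf.prob (reflected_walk x) {y. n \<le> gdist int_line x y} \<le> measure_pmf.prob (reflected_walk x) {- x}"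
          by (rule measure_pmf.finite_measure_mono_AE) (use flip in \<open>auto simp: AE_measure_pmf_iff\<close>)
        also have "\<dots> = reflection_rate N"
        proof -
          have "- x \<noteq> sgn1 x * (\<bar>x\<bar> + 1)" "- x \<noteq> sgn1 x * (\<bar>x\<bar> - 1)"
            unfolding sgn1_def by presburger+
          then show ?thesis
            by (simp add: measure_pmf_single pmf_flip_chain[OF flip_params_reflected_walk] flip_prob_def Let_def N_def)
        qed
        also have "\<dots> \<le> 1 / (real N + 1)\<^sup>2"
          by (rule reflection_rate_le_inverse_square)
        also have "\<dots> = 4 / (2 * (real N + 1))\<^sup>2"
          unfolding power_mult_distrib by simp
        also have "\<dots> \<le> 4 / (real n + 1)\<^sup>2"
          using True by (intro divide_left_mono power_mono mult_pos_pos) auto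
        finally show ?thesis
          by (simp add: T_def)
      next
        case no: False
        have "measure_pmf.prob (reflected_walk x) {y. n \<le> gdist int_line x y} \<le> measure_pmf.prob (reflected_walk x) {}"
          by (rule measure_pmf.finite_measure_mono_AE) (use flip no in \<open>auto simp: AE_measure_pmf_iff\<close>)
        then show ?thesis
          using T_nonneg[of n] by simp
      qed
    qed
    then show "measure_pmf.prob (step_distribution int_line reflected_walk x) {n..} \<le> measure_pmf.prob \<sigma> {n..}"
      by (simp add: step_distribution_def tails vimage_def)
  qed
  moreover have "summable (\<lambda>n. real n * pmf \<sigma> n)"
    unfolding pmf by (rule summable_mean_if_summable_tails[OF dec T_nonneg sum])
  ultimately show ?thesis
    unfolding uniform_first_moment_def by blast
qed

section \<open>Infinitely many sign changes\<close>

text \<open>The probability that the walk from \<open>x\<close> keeps its sign for \<open>k\<close> steps, as a real number.\<close>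
definition sign_survival :: "nat \<Rightarrow> int \<Rightarrow> real" where
  "sign_survival k x = enn2real ((restricted_op (\<lambda>x y. sgn1 x = sgn1 y) reflected_walk ^^ k) (\<lambda>_. 1) x)"

lemma ennreal_sign_survival:
  "ennreal (sign_survival k x) = (restricted_op (\<lambda>x y. sgn1 x = sgn1 y) reflected_walk ^^ k) (\<lambda>_. 1) x"
  unfolding sign_survival_def
  by (rule ennreal_enn2real) (rule le_less_trans[OF restricted_op_power_le_1], simp)

lemma sign_survival_nonneg: "0 \<le> sign_survival k x"
  by (simp add: sign_survival_def)

lemma sign_survival_le_1: "sign_survival k x \<le> 1"
  using restricted_op_power_le_1[of k "\<lambda>x y. sgn1 x = sgn1 y" reflected_walk x] ennreal_le_1
  by (simp add: ennreal_sign_survival[symmetric])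

lemma decseq_sign_survival: "decseq (\<lambda>k. sign_survival k x)"
  using decseq_restricted_op_power[of "\<lambda>x y. sgn1 x = sgn1 y" reflected_walk x]
  by (simp add: ennreal_sign_survival[symmetric] decseq_def sign_survival_nonneg)

lemma sign_survival_Suc:
  fixes x :: int
  assumes n_def: "n = nat \<bar>x\<bar>"
  shows "sign_survival (Suc k) x =
    (1 - reflection_rate n) * ((1 + outward_drift n) / 2) * sign_survival k (sgn1 x * (\<bar>x\<bar> + 1)) +
    (1 - reflection_rate n) * ((1 - outward_drift n) / 2) *
      (of_bool (sgn1 (sgn1 x * (\<bar>x\<bar> - 1)) = sgn1 x) * sign_survival k (sgn1 x * (\<bar>x\<bar> - 1)))"
    (is "_ = ?up * _ + ?down * _")
proof -
  let ?R = "\<lambda>x y. sgn1 x = sgn1 y"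
  let ?f = "\<lambda>y. of_bool (?R x y) * ennreal (sign_survival k y)"
  have nonneg: "0 \<le> ?up" "0 \<le> ?down"
    using flip_params_reflected_walk by (auto simp: flip_params_def)
  have up: "sgn1 (sgn1 x * (\<bar>x\<bar> + 1)) = sgn1 x"
    by (auto simp: sgn1_def)
  have "x \<noteq> 0 \<Longrightarrow> sgn1 x \<noteq> sgn1 (- x)"
    by (auto simp: sgn1_def)
  \<comment> \<open>A reflection changes the sign, except at the origin, where its rate is 0.\<close>
  then have flip: "ennreal (reflection_rate n) * ?f (- x) = 0"
    by (cases "x = 0") (auto simp: n_def reflection_rate_0)
  have f: "?f y = ennreal (of_bool (?R x y) * sign_survival k y)" for y
    by simp
  have "ennreal (sign_survival (Suc k) x) = (\<integral>\<^sup>+y. ?f y \<partial>reflected_walk x)"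
    by (simp add: ennreal_sign_survival restricted_op_def)
  also have "\<dots> = ennreal ?up * ?f (sgn1 x * (\<bar>x\<bar> + 1)) + ennreal ?down * ?f (sgn1 x * (\<bar>x\<bar> - 1))"
    unfolding nn_integral_flip_chain[OF flip_params_reflected_walk n_def] flip by simp
  also have "\<dots> = ennreal (?up * (of_bool (?R x (sgn1 x * (\<bar>x\<bar> + 1))) * sign_survival k (sgn1 x * (\<bar>x\<bar> + 1))) +
      ?down * (of_bool (?R x (sgn1 x * (\<bar>x\<bar> - 1))) * sign_survival k (sgn1 x * (\<bar>x\<bar> - 1))))"
    unfolding f using nonneg sign_survival_nonneg
    by (simp only: ennreal_mult'[symmetric]) (subst ennreal_plus[symmetric]; simp)
  finally have "sign_survival (Suc k) x =
      ?up * (of_bool (?R x (sgn1 x * (\<bar>x\<bar> + 1))) * sign_survival k (sgn1 x * (\<bar>x\<bar> + 1))) +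
      ?down * (of_bool (?R x (sgn1 x * (\<bar>x\<bar> - 1))) * sign_survival k (sgn1 x * (\<bar>x\<bar> - 1)))"
  proof (rule ennreal_inj[THEN iffD1, rotated 2])
    show "0 \<le> ?up * (of_bool (?R x (sgn1 x * (\<bar>x\<bar> + 1))) * sign_survival k (sgn1 x * (\<bar>x\<bar> + 1))) +
      ?down * (of_bool (?R x (sgn1 x * (\<bar>x\<bar> - 1))) * sign_survival k (sgn1 x * (\<bar>x\<bar> - 1)))"
      by (intro add_nonneg_nonneg mult_nonneg_nonneg nonneg sign_survival_nonneg) auto
  qed (rule sign_survival_nonneg)
  moreover have "?R x (sgn1 x * (\<bar>x\<bar> - 1)) \<longleftrightarrow> sgn1 (sgn1 x * (\<bar>x\<bar> - 1)) = sgn1 x"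
    by (rule eq_commute)
  ultimately show ?thesis
    unfolding up by (simp only: simp_thms of_bool_eq mult_1)
qed

text \<open>The expected number of visits of the absolute value to \<open>n\<close> is of order \<open>n\<close>; so this divergence
  says that the expected number of reflections is infinite.\<close>
lemma reflection_rate_not_summable_against_Green_function:
  "\<not> summable (\<lambda>n. real n * (2 * reflection_rate n))"
proof
  assume "summable (\<lambda>n. real n * (2 * reflection_rate n))"
  then have "summable (\<lambda>n. 2 * (real n * (2 * reflection_rate n)))"
    by (rule summable_mult)
  then have "summable (\<lambda>n. inverse (real (Suc n)))"
  proof (rule summable_comparison_test'[where N = 1])
    fix n :: nat assume "1 \<le> n"
    then have "(real n + 1)\<^sup>2 \<le> (2 * real n)\<^sup>2"
      by (intro power_mono) auto
    then have "(real n + 1) ^ 3 \<le> 4 * (real n)\<^sup>2 * (real n + 1)"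
      by (simp add: power3_eq_cube power2_eq_square)
    then show "norm (inverse (real (Suc n))) \<le> 2 * (real n * (2 * reflection_rate n))"
      by (simp add: reflection_rate_def divide_simps power2_eq_square add.commute mult.assoc)
  qed
  then show False
    using not_summable_harmonic[where 'a = real] summable_Suc_iff[of "\<lambda>n. inverse (real n)"] by blast
qed

text \<open>The one-step equation of the survival probability, multiplied by \<open>n + 1\<close>, has the form of the
  hypothesis on \<open>b\<close>: only the loss factor \<open>1 - p\<close> distinguishes it from a vanishing second difference.\<close>
lemma convexity_defect:
  fixes p a b c :: real
  assumes "0 \<le> p" "p \<le> 1" "0 \<le> a" "0 \<le> c" and "2 * b = (1 - p) * (a + c)"
  shows "a - 2 * b + c \<ge> 2 * p * b"
proof -
  have "2 * b \<le> a + c"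
    unfolding assms(5) using assms(1-4) by (intro mult_left_le_one_le) auto
  then have "p * (2 * b) \<le> p * (a + c)"
    using assms(1) by (rule mult_left_mono)
  then show ?thesis
    using assms(5) by (simp add: algebra_simps)
qed

text \<open>The limit \<open>u\<close> of the survival probabilities is harmonic for the killed walk. On either half-line
  \<open>(n + 1) u\<close> is a nonnegative sequence of at most linear growth, vanishing just outside the half-line,
  whose second difference is at least \<open>2 * reflection_rate n\<close> times the sequence itself.
  As \<open>n * reflection_rate n\<close> is not summable, it is zero.\<close>
lemma sign_survival_tendsto_0: "(\<lambda>k. sign_survival k x) \<longlonglongrightarrow> 0"
proof -
  have "\<exists>l. (\<lambda>k. sign_survival k x) \<longlonglongrightarrow> l" for x
    by (rule decseq_convergent[OF decseq_sign_survival[of x], of 0]) (auto simp: sign_survival_nonneg)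
  then obtain u where u: "(\<lambda>k. sign_survival k x) \<longlonglongrightarrow> u x" for x
    by metis
  have u_nonneg: "0 \<le> u x" for x
    by (rule LIMSEQ_le_const[OF u]) (simp add: sign_survival_nonneg)
  have u_le_1: "u x \<le> 1" for x
    by (rule LIMSEQ_le_const2[OF u]) (simp add: sign_survival_le_1)
  have harmonic: "2 * (real n + 1) * u x = (1 - reflection_rate n) *
      ((real n + 2) * u (sgn1 x * (int n + 1)) +
       real n * (of_bool (sgn1 (sgn1 x * (int n - 1)) = sgn1 x) * u (sgn1 x * (int n - 1))))"
    if n: "n = nat \<bar>x\<bar>" for n x
  proof -
    have absx: "\<bar>x\<bar> = int n"
      using n by simp
    have coeff: "(1 - reflection_rate n) * ((1 + outward_drift n) / 2) = (1 - reflection_rate n) * (real n + 2) / (2 * (real n + 1))"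
      "(1 - reflection_rate n) * ((1 - outward_drift n) / 2) = (1 - reflection_rate n) * real n / (2 * (real n + 1))"
      by (simp_all add: outward_drift_def field_simps)
    have "(\<lambda>k. sign_survival (Suc k) x) \<longlonglongrightarrow>
        (1 - reflection_rate n) * (real n + 2) / (2 * (real n + 1)) * u (sgn1 x * (int n + 1)) +
        (1 - reflection_rate n) * real n / (2 * (real n + 1)) *
          (of_bool (sgn1 (sgn1 x * (int n - 1)) = sgn1 x) * u (sgn1 x * (int n - 1)))"
      unfolding sign_survival_Suc[OF n] absx coeff by (intro tendsto_intros u)
    note limit_eq = LIMSEQ_unique[OF LIMSEQ_Suc[OF u] this]
    have clear_denominators: "2 * m * v = r * (s * A + t * B)"
      if "v = r * s / (2 * m) * A + r * t / (2 * m) * B" "m > 0" for m v r s t A B :: real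
      using that by (simp add: field_simps)
    show ?thesis
      by (rule clear_denominators[OF limit_eq]) simp
  qed
  have rate_le_1: "reflection_rate n \<le> 1" for n
    using reflection_rate_le_half[of n] by simp
  have u_pos_half: "u (int n) = 0" for n
  proof -
    \<comment> \<open>The origin counts as positive: the half-line starts at 0, and the index is shifted by one so that \<open>w 0\<close> belongs to the point \<open>-1\<close>.\<close>
    define w where "w j = real j * u (int j - 1)" for j
    have "w (Suc n) = 0"
    proof (rule convex_sequence_forced_zero[where C = 1 and q = "\<lambda>j. 2 * reflection_rate (j - 1)"])
      show "w 0 = 0" "0 \<le> w j" "0 \<le> 2 * reflection_rate (j - 1)" for j
        by (simp_all add: w_def u_nonneg reflection_rate_nonneg)
      show "w j \<le> 1 * (real j + 1)" for j
        using mult_left_mono[OF u_le_1[of "int j - 1"], of "real j"] by (simp add: w_def)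
      show "2 * reflection_rate (Suc j - 1) * w (Suc j) \<le> w (Suc (Suc j)) - 2 * w (Suc j) + w j" for j
      proof (rule convexity_defect)
        have "j = nat \<bar>int j\<bar>"
          by simp
        note harmonic = harmonic[OF this]
        have below: "real j * (of_bool (sgn1 (sgn1 (int j) * (int j - 1)) = sgn1 (int j)) * u (sgn1 (int j) * (int j - 1))) =
            real j * u (int j - 1)"
          by (cases "j = 0") (auto simp: sgn1_def)
        show "2 * w (Suc j) = (1 - reflection_rate (Suc j - 1)) * (w (Suc (Suc j)) + w j)"
          using harmonic unfolding below by (simp add: w_def sgn1_def algebra_simps)
      qed (simp_all add: w_def u_nonneg reflection_rate_nonneg rate_le_1)
      show "\<not> summable (\<lambda>j. real j * (2 * reflection_rate (j - 1)))"
      proof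
        assume "summable (\<lambda>j. real j * (2 * reflection_rate (j - 1)))"
        then have "summable (\<lambda>j. real (Suc j) * (2 * reflection_rate (Suc j - 1)))"
          by (subst summable_Suc_iff)
        then have "summable (\<lambda>j. real j * (2 * reflection_rate j))"
          by (rule summable_comparison_test') (auto simp: reflection_rate_nonneg intro!: mult_right_mono)
        then show False
          using reflection_rate_not_summable_against_Green_function by blast
      qed
    qed
    then show ?thesis
      by (simp add: w_def)
  qed
  have u_neg_half: "u (- int n) = 0" if "n > 0" for n
  proof -
    \<comment> \<open>On the negative half-line reaching 0 is already a sign change, hence the boundary value 0 at the origin.\<close>
    define w where "w j = of_bool (j > 0) * ((real j + 1) * u (- int j))" for j :: nat
    have "w n = 0"
    proof (rule convex_sequence_forced_zero[where C = 1 and q = "\<lambda>j. 2 * reflection_rate j"])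
      show "w 0 = 0" "0 \<le> w j" "0 \<le> 2 * reflection_rate j" for j
        by (simp_all add: w_def u_nonneg reflection_rate_nonneg)
      show "w j \<le> 1 * (real j + 1)" for j
        using mult_left_mono[OF u_le_1[of "- int j"], of "real j + 1"] by (simp add: w_def)
      show "2 * reflection_rate (Suc j) * w (Suc j) \<le> w (Suc (Suc j)) - 2 * w (Suc j) + w j" for j
      proof (rule convexity_defect)
        let ?x = "- int (Suc j)"
        have "Suc j = nat \<bar>?x\<bar>"
          by simp
        note harmonic = harmonic[OF this]
        have centre: "2 * (real (Suc j) + 1) * u ?x = 2 * w (Suc j)"
          by (simp add: w_def)
        have above: "(real (Suc j) + 2) * u (sgn1 ?x * (int (Suc j) + 1)) = w (Suc (Suc j))"
          by (simp add: w_def sgn1_def algebra_simps)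
        have below: "real (Suc j) * (of_bool (sgn1 (sgn1 ?x * (int (Suc j) - 1)) = sgn1 ?x) * u (sgn1 ?x * (int (Suc j) - 1))) = w j"
          by (cases "j = 0") (auto simp: w_def sgn1_def)
        show "2 * w (Suc j) = (1 - reflection_rate (Suc j)) * (w (Suc (Suc j)) + w j)"
          using harmonic unfolding centre above below .
      qed (simp_all add: w_def u_nonneg reflection_rate_nonneg rate_le_1)
      show "\<not> summable (\<lambda>j. real j * (2 * reflection_rate j))"
        by (rule reflection_rate_not_summable_against_Green_function)
    qed
    with that show ?thesis
      by (simp add: w_def)
  qed
  have "u x = 0"
    using u_pos_half[of "nat x"] u_neg_half[of "nat (- x)"] by (cases "x \<ge> 0") auto
  with u[of x] show ?thesis
    by simp
qed

lemma AE_sign_changes_infinitely_often: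
  "AE \<omega> in path_measure reflected_walk x. \<exists>\<^sub>\<infinity>k. \<not> sgn1 (\<omega> k) = sgn1 (\<omega> (Suc k))"
proof (rule AE_infinitely_often_not_if_restricted_vanishes)
  fix z
  have "(\<lambda>k. ennreal (sign_survival k z)) \<longlonglongrightarrow> ennreal 0"
    by (intro tendsto_ennrealI sign_survival_tendsto_0)
  then show "(\<lambda>k. (restricted_op (\<lambda>x y. sgn1 x = sgn1 y) reflected_walk ^^ k) (\<lambda>_. 1) z) \<longlonglongrightarrow> 0"
    by (simp add: ennreal_sign_survival)
qed

section \<open>Expected sign changes and ends\<close>

lemma suminf_of_bool_eq_top:
  assumes "\<exists>\<^sub>\<infinity>k. A k"
  shows "(\<Sum>k. of_bool (A k) :: ennreal) = \<infinity>"
proof -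
  have "infinite {k. A k}"
    using assms by (simp add: frequently_cofinite)
  have "(\<Sum>k. of_bool (A k) :: ennreal) = (\<integral>\<^sup>+k. indicator {k. A k} k \<partial>count_space UNIV)"
    by (simp add: nn_integral_count_space_nat indicator_def of_bool_def)
  also have "\<dots> = \<infinity>"
    using \<open>infinite {k. A k}\<close> by (simp add: nn_integral_indicator)
  finally show ?thesis .
qed

lemma expected_sign_changes_reflected_walk: "expected_sign_changes reflected_walk x = \<infinity>"
proof -
  interpret prob_space "path_measure reflected_walk x"
    by (rule prob_space_path_measure)
  have "expected_sign_changes reflected_walk x = (\<integral>\<^sup>+\<omega>. \<infinity> \<partial>path_measure reflected_walk x)"
    unfolding expected_sign_changes_def
  proof (rule nn_integral_cong_AE)
    show "AE \<omega> in path_measure reflected_walk x. (\<Sum>k. of_bool (sgn1 (\<omega> (Suc k)) \<noteq> sgn1 (\<omega> k)) :: ennreal) = \<infinity>"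
      using AE_sign_changes_infinitely_often[of x]
      by eventually_elim (rule suminf_of_bool_eq_top, erule frequently_elim1, simp)
  qed
  then show ?thesis
    by (simp add: emeasure_space_1[simplified])
qed

lemma not_converges_reflected_walk: "\<not> converges_as_to_end int_line reflected_walk"
proof
  assume conv: "converges_as_to_end int_line reflected_walk"
  interpret prob_space "path_measure reflected_walk 0"
    by (rule prob_space_path_measure)
  have "AE \<omega> in path_measure reflected_walk 0. \<exists>U\<in>end_space int_line. converges_to_end int_line \<omega> U"
    using conv by (simp add: converges_as_to_end_def int_line_def)
  with AE_sign_changes_infinitely_often[of 0] have "AE \<omega> in path_measure reflected_walk 0. False"
    by eventually_elim (use not_converges_to_end_if_sign_alternates in blast)
  then show False
    by simp
qed

text \<open>Almost sure infinitude of the sign changes gives both the infinite expectation and the failure of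
  convergence to an end; the first claim is an instance of the second.\<close>
theorem proposition2p6:
  shows "(\<exists>(G :: int pair_pre_digraph) P.
            loc_finite_graph G \<and> markov_operator_on G P \<and>
            transient_walk G P \<and> uniformly_irreducible G P \<and> uniform_first_moment G P \<and>
            \<not> converges_as_to_end G P)
       \<and> (\<exists>p \<epsilon>. flip_params p \<epsilon> \<and>
            loc_finite_graph int_line \<and> markov_operator_on int_line (flip_chain p \<epsilon>) \<and>
            transient_walk int_line (flip_chain p \<epsilon>) \<and>
            uniformly_irreducible int_line (flip_chain p \<epsilon>) \<and>
            uniform_first_moment int_line (flip_chain p \<epsilon>) \<and>
            (\<forall>x. expected_sign_changes (flip_chain p \<epsilon>) x = \<infinity>) \<and>
            \<not> converges_as_to_end int_line (flip_chain p \<epsilon>))"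
proof -
  have "markov_operator_on int_line reflected_walk"
    by (simp add: markov_operator_on_def int_line_def)
  note walk = loc_finite_graph_int_line this transient_reflected_walk
    uniformly_irreducible_reflected_walk uniform_first_moment_reflected_walk
  show ?thesis
    using walk flip_params_reflected_walk expected_sign_changes_reflected_walk not_converges_reflected_walk
    by blast
qed

end
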